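(* For all statements $p,p'$ of loop-free Kernel Esterel, all events $E,E'$ and all $k\in\mathbb N$: if $E$ is total and $\mathrm{CBS}(p,E,E',k,p')$ holds in the constructive behavioral semantics, then $\mathrm{LBS}(p,\mathrm{C2K}(E),\mathrm{C2K}(E'),k,p')$ holds in the logical behavioral semantics.
   Context: **Syntax.** Fix an infinite set of signals with decidable equality. A literal $\ell$ is $s$ or $\neg s$. Statements (loop-free Kernel Esterel): $p,q ::= 0 \mid 1 \mid k\ (k\ge 2) \mid\ !s \mid @\ell \mid s?p,q \mid s\supset p \mid \{p\} \mid\ \uparrow p \mid p;q \mid p|q \mid p\backslash s$ (nothing, pause, exit, emit, await immediate, presence test, suspend, trap, shift, sequence, parallel, local signal). **Codes.** $\downarrow0=0,\downarrow1=1,\downarrow2=0,\downarrow n=n-1$ ($n\ge3$); $\uparrow0=0,\uparrow1=1,\uparrow n=n+1$ ($n\ge2$); extended elementwise to sets; $\mathrm{Max}(K,L)=\{\max(k,l):k\in K,l\in L\}$. **Events.** Statuses $\bot,+,-$. A (constructive) event $E$ is a finite partial map from signals to statuses; it is total if it takes no value $\bot$. A classical event is a finite partial map from signals to $\{+,-\}$. For total $E$, $\mathrm{C2K}(E)$ is the same map viewed as a classical event (outputs of $\mathrm{CBS}$ are always total). $E(s):=\bot$ if $s\notin\mathrm{dom}(E)$; $E(\neg s):=\neg E(s)$ with $\neg$ swapping $+,-$ and fixing $\bot$. $E*s^b$ has domain $\mathrm{dom}(E)\cup\{s\}$, maps $s$ to $b$ and agrees with $E$ elsewhere. Given input event $E$,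 output events are maps with domain $\mathrm{dom}(E)$: $\emptyset$ maps all to $-$; $\{s^+\}$ maps $s$ to $+$, the rest to $-$; $E_1\cup E_2$ is pointwise with $+\vee x=x\vee+=+$, $-\vee-=-$, else $\bot$. For $E'$ with domain $\mathrm{dom}(E)\cup\{s\}$, $E'\setminus s$ is the map on $\mathrm{dom}(E)$ agreeing with $E'$ off $s$ and mapping $s$ to $-$ if $s\in\mathrm{dom}(E)$. **Must/Can.** For $m\in\{+,\bot\}$, $\mathrm{Must}(p,E)$, $\mathrm{Can}^m(p,E)$ are pairs (set of signals, set of codes), components indexed $s,k$; unions componentwise; $X\setminus0$ removes code $0$, $X\setminus s$ removes signal $s$. - $\mathrm{Must}(k,E)=\mathrm{Can}^m(k,E)=(\emptyset,\{k\})$ for $k\ge0$; $\mathrm{Must}(!s,E)=\mathrm{Can}^m(!s,E)=(\{s\},\{0\})$. - $@\ell$: both $(\emptyset,\{0\})$ if $E(\ell)=+$, $(\emptyset,\{1\})$ if $E(\ell)=-$; otherwise Must is $(\emptyset,\emptyset)$, $\mathrm{Can}^m$ is $(\emptyset,\{0,1\})$. - $s?p,q$: if $E(s)=+$, the value (Must, resp. $\mathrm{Can}^m$) for $p$; if $E(s)=-$, that for $q$; otherwise Must is $(\emptyset,\emptyset)$, $\mathrm{Can}^m$ is $\mathrm{Can}^\bot(p,E)\cup\mathrm{Can}^\bot(q,E)$. - $s\supset p$: same as $p$. $\{p\}$ (resp. $\uparrow p$): same signals as $p$, codes mapped by $\downarrow$ (resp. $\uparrow$). - $\mathrm{Must}(p;q,E)=\mathrm{Must}(p,E)$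 if $0\notin\mathrm{Must}_k(p,E)$, else $(\mathrm{Must}_s(p,E)\cup\mathrm{Must}_s(q,E),\mathrm{Must}_k(q,E))$. $\mathrm{Can}^m(p;q,E)=\mathrm{Can}^m(p,E)$ if $0\notin\mathrm{Can}^m_k(p,E)$; else $(\mathrm{Can}^m(p,E)\setminus0)\cup\mathrm{Can}^+(q,E)$ if $0\in\mathrm{Must}_k(p,E)$ and $m=+$; else $(\mathrm{Can}^m(p,E)\setminus0)\cup\mathrm{Can}^\bot(q,E)$. - $p|q$: union of signals, $\mathrm{Max}$ of code sets. - $\mathrm{Must}(p\backslash s,E)=\mathrm{Must}(p,E*s^b)\setminus s$ with $b=+$ if $s\in\mathrm{Must}_s(p,E*s^\bot)$; else $b=-$ if $s\notin\mathrm{Can}^+_s(p,E*s^\bot)$; else $b=\bot$. $\mathrm{Can}^m(p\backslash s,E)=\mathrm{Can}^m(p,E*s^b)\setminus s$ with $b=+$ if $s\in\mathrm{Must}_s(p,E*s^\bot)$ and $m=+$; else $b=-$ if $s\notin\mathrm{Can}^m_s(p,E*s^\bot)$; else $b=\bot$. **Semantics.** $\delta(k,p)=p$ if $k=1$, and $0$ otherwise. $\mathrm{CBS}(p,E,E',k,p')$ (constructive input events $E$) and $\mathrm{LBS}(p,E,E',k,p')$ (classical input events $E$) are the least relations, $R\in\{\mathrm{CBS},\mathrm{LBS}\}$, closed under the common rules: - $R(k,E,\emptyset,k,0)$ for $k\ge0$; $R(!s,E,\{s^+\},0,0)$ if $s\in\mathrm{dom}(E)$; $R(@\ell,E,\emptyset,0,0)$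 if $E(\ell)=+$; $R(@\ell,E,\emptyset,1,@\ell)$ if $E(\ell)=-$. - If $E(s)=+$ and $R(p,E,E',k,p')$: $R(s?p,q,\ E,E',k,p')$; if $E(s)=-$ and $R(q,E,E',k,q')$: $R(s?p,q,\ E,E',k,q')$. - If $R(p,E,E',k,p')$: $R(s\supset p,E,E',k,\delta(k,\ @\neg s;(s\supset p')))$ provided $s\in\mathrm{dom}(E)$; $R(\{p\},E,E',\downarrow k,\delta(\downarrow k,\{p'\}))$; $R(\uparrow p,E,E',\uparrow k,\delta(\uparrow k,\uparrow p'))$; if $k\ne0$, $R(p;q,E,E',k,\delta(k,p';q))$. - If $R(p,E,E'_p,0,p')$ and $R(q,E,E'_q,k,q')$: $R(p;q,E,E'_p\cup E'_q,k,q')$. - If $R(p,E,E'_p,k_p,p')$, $R(q,E,E'_q,k_q,q')$, $k=\max(k_p,k_q)$: $R(p|q,E,E'_p\cup E'_q,k,\delta(k,p'|q'))$. and under the following rules for local signals: - CBS: if $s\in\mathrm{Must}_s(p,E*s^\bot)$ and $\mathrm{CBS}(p,E*s^+,E',k,p')$, or $s\notin\mathrm{Can}^+_s(p,E*s^\bot)$ and $\mathrm{CBS}(p,E*s^-,E',k,p')$, then $\mathrm{CBS}(p\backslash s,E,E'\setminus s,k,\delta(k,p'\backslash s))$. - LBS: if $\mathrm{LBS}(p,E*s^+,E',k,p')$ and $E'(s)=+$, or $\mathrm{LBS}(p,E*s^-,E',k,p')$ and $E'(s)\ne+$, then $\mathrm{LBS}(p\backslash s,E,E'\setminus s,k,\delta(k,p'\backslash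 s))$. *)

theory Defs
  imports "HOL-Library.Finite_Map" "HOL-Library.Infinite_Typeclass"
begin

datatype 's literal = Sig 's | NotSig 's

(* Code 0 is "nothing", Code 1 is "pause", and Code k with k >= 2 is "exit k".
   Must, Can and the transition rules treat all of them by one clause. *)
datatype 's stm =
    Code nat
  | Emit 's
  | Await "'s literal"
  | Present 's "'s stm" "'s stm"
  | Suspend 's "'s stm"
  | Trap "'s stm"
  | Shift "'s stm"
  | Seq "'s stm" "'s stm"
  | Par "'s stm" "'s stm"
  | Local "'s stm" 's

definition down :: "nat \<Rightarrow> nat" where
  "down n = (if n = 0 then 0 else if n = 1 then 1 else if n = 2 then 0 else n - 1)"

definition up :: "nat \<Rightarrow> nat" where
  "up n = (if n = 0 then 0 else if n = 1 then 1 else n + 1)"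

definition Max_codes :: "nat set \<Rightarrow> nat set \<Rightarrow> nat set" where
  "Max_codes K L = {max k l | k l. k \<in> K \<and> l \<in> L}"

definition delta :: "nat \<Rightarrow> 's stm \<Rightarrow> 's stm" where
  "delta k p = (if k = 1 then p else Code 0)"

datatype status = Bot | Plus | Minus

datatype cstatus = CPlus | CMinus

type_synonym 's event = "('s, status) fmap"
type_synonym 's cevent = "('s, cstatus) fmap"

definition total_event :: "'s event \<Rightarrow> bool" where
  "total_event E \<longleftrightarrow> (\<forall>s. fmlookup E s \<noteq> Some Bot)"

(* The value at Bot is irrelevant: C2K is only meaningful on total events, and
   outputs of CBS are always total. *)
primrec c2k_status :: "status \<Rightarrow> cstatus" where
  "c2k_status Plus = CPlus"
| "c2k_status Minus = CMinus"
| "c2k_status Bot = undefined"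

definition C2K :: "'s event \<Rightarrow> 's cevent" where
  "C2K E = fmmap c2k_status E"

primrec k2c_status :: "cstatus \<Rightarrow> status" where
  "k2c_status CPlus = Plus"
| "k2c_status CMinus = Minus"

(* For both kinds of events, E(s) is a status, namely Bot outside the domain. *)
definition val :: "'s event \<Rightarrow> 's \<Rightarrow> status" where
  "val E s = (case fmlookup E s of None \<Rightarrow> Bot | Some b \<Rightarrow> b)"

definition cval :: "'s cevent \<Rightarrow> 's \<Rightarrow> status" where
  "cval E s = (case fmlookup E s of None \<Rightarrow> Bot | Some b \<Rightarrow> k2c_status b)"

primrec neg_status :: "status \<Rightarrow> status" where
  "neg_status Bot = Bot"
| "neg_status Plus = Minus"
| "neg_status Minus = Plus"

primrec lit_val :: "'s event \<Rightarrow> 's literal \<Rightarrow> status" where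
  "lit_val E (Sig s) = val E s"
| "lit_val E (NotSig s) = neg_status (val E s)"

primrec lit_cval :: "'s cevent \<Rightarrow> 's literal \<Rightarrow> status" where
  "lit_cval E (Sig s) = cval E s"
| "lit_cval E (NotSig s) = neg_status (cval E s)"

definition out_none :: "'s event \<Rightarrow> 's event" where
  "out_none E = fmmap (\<lambda>_. Minus) E"

definition cout_none :: "'s cevent \<Rightarrow> 's cevent" where
  "cout_none E = fmmap (\<lambda>_. CMinus) E"

definition out_single :: "'s event \<Rightarrow> 's \<Rightarrow> 's event" where
  "out_single E s = fmmap_keys (\<lambda>t _. if t = s then Plus else Minus) E"

definition cout_single :: "'s cevent \<Rightarrow> 's \<Rightarrow> 's cevent" where
  "cout_single E s = fmmap_keys (\<lambda>t _. if t = s then CPlus else CMinus) E"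

definition join_status :: "status \<Rightarrow> status \<Rightarrow> status" where
  "join_status a b =
     (if a = Plus \<or> b = Plus then Plus
      else if a = Minus \<and> b = Minus then Minus else Bot)"

definition join_cstatus :: "cstatus \<Rightarrow> cstatus \<Rightarrow> cstatus" where
  "join_cstatus a b = (if a = CPlus \<or> b = CPlus then CPlus else CMinus)"

(* Only used on maps with equal domains, hence the choice of the common domain
   for the result is harmless. *)
context includes fmap.lifting begin

lift_definition fmpointwise ::
    "('b \<Rightarrow> 'b \<Rightarrow> 'b) \<Rightarrow> ('a, 'b) fmap \<Rightarrow> ('a, 'b) fmap \<Rightarrow> ('a, 'b) fmap"
  is "\<lambda>f m n x. case m x of None \<Rightarrow> None
        | Some a \<Rightarrow> (case n x of None \<Rightarrow> None | Some b \<Rightarrow> Some (f a b))"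
  by (rule finite_subset) (auto simp: dom_def split: option.splits)

end

definition event_union :: "'s event \<Rightarrow> 's event \<Rightarrow> 's event" where
  "event_union = fmpointwise join_status"

definition cevent_union :: "'s cevent \<Rightarrow> 's cevent \<Rightarrow> 's cevent" where
  "cevent_union = fmpointwise join_cstatus"

(* The output E' without s, relative to the input E.  Since E' has domain
   dom E \<union> {s}, the result has domain dom E. *)
definition hide :: "'s event \<Rightarrow> 's event \<Rightarrow> 's \<Rightarrow> 's event" where
  "hide E E' s = (if s |\<in>| fmdom E then fmupd s Minus E' else fmdrop s E')"

definition chide :: "'s cevent \<Rightarrow> 's cevent \<Rightarrow> 's \<Rightarrow> 's cevent" where
  "chide E E' s = (if s |\<in>| fmdom E then fmupd s CMinus E' else fmdrop s E')"

datatype mode = MPlus | MBot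

type_synonym 's sigcodes = "'s set \<times> nat set"

definition sc_union :: "'s sigcodes \<Rightarrow> 's sigcodes \<Rightarrow> 's sigcodes" where
  "sc_union X Y = (fst X \<union> fst Y, snd X \<union> snd Y)"

definition sc_minus0 :: "'s sigcodes \<Rightarrow> 's sigcodes" where
  "sc_minus0 X = (fst X, snd X - {0})"

definition sc_minus_sig :: "'s sigcodes \<Rightarrow> 's \<Rightarrow> 's sigcodes" where
  "sc_minus_sig X s = (fst X - {s}, snd X)"

fun must :: "'s stm \<Rightarrow> 's event \<Rightarrow> 's sigcodes"
and can :: "mode \<Rightarrow> 's stm \<Rightarrow> 's event \<Rightarrow> 's sigcodes"
where
  "must (Code k) E = ({}, {k})"
| "must (Emit s) E = ({s}, {0})"
| "must (Await l) E =
     (case lit_val E l of Plus \<Rightarrow> ({}, {0}) | Minus \<Rightarrow> ({}, {1}) | Bot \<Rightarrow> ({}, {}))"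
| "must (Present s p q) E =
     (case val E s of Plus \<Rightarrow> must p E | Minus \<Rightarrow> must q E | Bot \<Rightarrow> ({}, {}))"
| "must (Suspend s p) E = must p E"
| "must (Trap p) E = (fst (must p E), down ` snd (must p E))"
| "must (Shift p) E = (fst (must p E), up ` snd (must p E))"
| "must (Seq p q) E =
     (if 0 \<notin> snd (must p E) then must p E
      else (fst (must p E) \<union> fst (must q E), snd (must q E)))"
| "must (Par p q) E =
     (fst (must p E) \<union> fst (must q E), Max_codes (snd (must p E)) (snd (must q E)))"
| "must (Local p s) E =
     sc_minus_sig
       (must p (fmupd s
          (if s \<in> fst (must p (fmupd s Bot E)) then Plus
           else if s \<notin> fst (can MPlus p (fmupd s Bot E)) then Minus
           else Bot) E)) s"

| "can m (Code k) E = ({}, {k})"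
| "can m (Emit s) E = ({s}, {0})"
| "can m (Await l) E =
     (case lit_val E l of Plus \<Rightarrow> ({}, {0}) | Minus \<Rightarrow> ({}, {1}) | Bot \<Rightarrow> ({}, {0, 1}))"
| "can m (Present s p q) E =
     (case val E s of Plus \<Rightarrow> can m p E | Minus \<Rightarrow> can m q E
      | Bot \<Rightarrow> sc_union (can MBot p E) (can MBot q E))"
| "can m (Suspend s p) E = can m p E"
| "can m (Trap p) E = (fst (can m p E), down ` snd (can m p E))"
| "can m (Shift p) E = (fst (can m p E), up ` snd (can m p E))"
| "can m (Seq p q) E =
     (if 0 \<notin> snd (can m p E) then can m p E
      else if 0 \<in> snd (must p E) \<and> m = MPlus
        then sc_union (sc_minus0 (can m p E)) (can MPlus q E)
      else sc_union (sc_minus0 (can m p E)) (can MBot q E))"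
| "can m (Par p q) E =
     (fst (can m p E) \<union> fst (can m q E), Max_codes (snd (can m p E)) (snd (can m q E)))"
| "can m (Local p s) E =
     sc_minus_sig
       (can m p (fmupd s
          (if s \<in> fst (must p (fmupd s Bot E)) \<and> m = MPlus then Plus
           else if s \<notin> fst (can m p (fmupd s Bot E)) then Minus
           else Bot) E)) s"

inductive CBS :: "'s stm \<Rightarrow> 's event \<Rightarrow> 's event \<Rightarrow> nat \<Rightarrow> 's stm \<Rightarrow> bool" where
  CBS_Code: "CBS (Code k) E (out_none E) k (Code 0)"
| CBS_Emit: "s |\<in>| fmdom E \<Longrightarrow> CBS (Emit s) E (out_single E s) 0 (Code 0)"
| CBS_Await_Plus: "lit_val E l = Plus \<Longrightarrow> CBS (Await l) E (out_none E) 0 (Code 0)"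
| CBS_Await_Minus: "lit_val E l = Minus \<Longrightarrow> CBS (Await l) E (out_none E) 1 (Await l)"
| CBS_Present_Plus:
    "val E s = Plus \<Longrightarrow> CBS p E E' k p' \<Longrightarrow> CBS (Present s p q) E E' k p'"
| CBS_Present_Minus:
    "val E s = Minus \<Longrightarrow> CBS q E E' k q' \<Longrightarrow> CBS (Present s p q) E E' k q'"
| CBS_Suspend:
    "CBS p E E' k p' \<Longrightarrow> s |\<in>| fmdom E \<Longrightarrow>
     CBS (Suspend s p) E E' k (delta k (Seq (Await (NotSig s)) (Suspend s p')))"
| CBS_Trap:
    "CBS p E E' k p' \<Longrightarrow> CBS (Trap p) E E' (down k) (delta (down k) (Trap p'))"
| CBS_Shift:
    "CBS p E E' k p' \<Longrightarrow> CBS (Shift p) E E' (up k) (delta (up k) (Shift p'))"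
| CBS_Seq_Stop:
    "CBS p E E' k p' \<Longrightarrow> k \<noteq> 0 \<Longrightarrow> CBS (Seq p q) E E' k (delta k (Seq p' q))"
| CBS_Seq_Next:
    "CBS p E E'p 0 p' \<Longrightarrow> CBS q E E'q k q' \<Longrightarrow>
     CBS (Seq p q) E (event_union E'p E'q) k q'"
| CBS_Par:
    "CBS p E E'p kp p' \<Longrightarrow> CBS q E E'q kq q' \<Longrightarrow> k = max kp kq \<Longrightarrow>
     CBS (Par p q) E (event_union E'p E'q) k (delta k (Par p' q'))"
| CBS_Local_Plus:
    "s \<in> fst (must p (fmupd s Bot E)) \<Longrightarrow> CBS p (fmupd s Plus E) E' k p' \<Longrightarrow>
     CBS (Local p s) E (hide E E' s) k (delta k (Local p' s))"
| CBS_Local_Minus: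
    "s \<notin> fst (can MPlus p (fmupd s Bot E)) \<Longrightarrow> CBS p (fmupd s Minus E) E' k p' \<Longrightarrow>
     CBS (Local p s) E (hide E E' s) k (delta k (Local p' s))"

inductive LBS :: "'s stm \<Rightarrow> 's cevent \<Rightarrow> 's cevent \<Rightarrow> nat \<Rightarrow> 's stm \<Rightarrow> bool" where
  LBS_Code: "LBS (Code k) E (cout_none E) k (Code 0)"
| LBS_Emit: "s |\<in>| fmdom E \<Longrightarrow> LBS (Emit s) E (cout_single E s) 0 (Code 0)"
| LBS_Await_Plus: "lit_cval E l = Plus \<Longrightarrow> LBS (Await l) E (cout_none E) 0 (Code 0)"
| LBS_Await_Minus: "lit_cval E l = Minus \<Longrightarrow> LBS (Await l) E (cout_none E) 1 (Await l)"
| LBS_Present_Plus: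
    "cval E s = Plus \<Longrightarrow> LBS p E E' k p' \<Longrightarrow> LBS (Present s p q) E E' k p'"
| LBS_Present_Minus:
    "cval E s = Minus \<Longrightarrow> LBS q E E' k q' \<Longrightarrow> LBS (Present s p q) E E' k q'"
| LBS_Suspend:
    "LBS p E E' k p' \<Longrightarrow> s |\<in>| fmdom E \<Longrightarrow>
     LBS (Suspend s p) E E' k (delta k (Seq (Await (NotSig s)) (Suspend s p')))"
| LBS_Trap:
    "LBS p E E' k p' \<Longrightarrow> LBS (Trap p) E E' (down k) (delta (down k) (Trap p'))"
| LBS_Shift:
    "LBS p E E' k p' \<Longrightarrow> LBS (Shift p) E E' (up k) (delta (up k) (Shift p'))"
| LBS_Seq_Stop:
    "LBS p E E' k p' \<Longrightarrow> k \<noteq> 0 \<Longrightarrow> LBS (Seq p q) E E' k (delta k (Seq p' q))"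
| LBS_Seq_Next:
    "LBS p E E'p 0 p' \<Longrightarrow> LBS q E E'q k q' \<Longrightarrow>
     LBS (Seq p q) E (cevent_union E'p E'q) k q'"
| LBS_Par:
    "LBS p E E'p kp p' \<Longrightarrow> LBS q E E'q kq q' \<Longrightarrow> k = max kp kq \<Longrightarrow>
     LBS (Par p q) E (cevent_union E'p E'q) k (delta k (Par p' q'))"
| LBS_Local_Plus:
    "LBS p (fmupd s CPlus E) E' k p' \<Longrightarrow> cval E' s = Plus \<Longrightarrow>
     LBS (Local p s) E (chide E E' s) k (delta k (Local p' s))"
| LBS_Local_Minus:
    "LBS p (fmupd s CMinus E) E' k p' \<Longrightarrow> cval E' s \<noteq> Plus \<Longrightarrow>
     LBS (Local p s) E (chide E E' s) k (delta k (Local p' s))"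

end

(* In a constructive derivation every status that is read is known, so Must (p, E) is exactly
   the set of emitted signals together with the returned code.  Must grows and Can shrinks when
   the input event gets more defined.  For a local signal s the test made at E * s^Bot therefore
   transfers to E * s^+ or E * s^-: if s is in Must it is emitted, and if s is not in Can^+ it
   is not in Must, hence not emitted.  These are the coherence conditions of LBS. *)
theory Submission imports Defs begin

section \<open>Orders of information on events, Must/Can values and modes\<close>

definition event_le :: "'s event \<Rightarrow> 's event \<Rightarrow> bool" where
  "event_le E F \<longleftrightarrow> (\<forall>s. val E s = Bot \<or> val E s = val F s)"

definition sc_le :: "'s sigcodes \<Rightarrow> 's sigcodes \<Rightarrow> bool" where
  "sc_le X Y \<longleftrightarrow> fst X \<subseteq> fst Y \<and> snd X \<subseteq> snd Y"

text \<open>\<open>MPlus\<close> is the better informed mode: its \<open>can\<close> sets lie within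
  those of \<open>MBot\<close>.\<close>

definition mode_le :: "mode \<Rightarrow> mode \<Rightarrow> bool" where
  "mode_le m n \<longleftrightarrow> m = MBot \<or> n = MPlus"

lemma val_fmupd [simp]: "val (fmupd s b E) t = (if t = s then b else val E t)"
  by (simp add: val_def)

lemma event_le_refl [simp]: "event_le E E"
  by (simp add: event_le_def)

lemma event_le_fmupd:
  "event_le E F \<Longrightarrow> a = Bot \<or> a = b \<Longrightarrow> event_le (fmupd s a E) (fmupd s b F)"
  by (auto simp: event_le_def)

lemma event_le_lit_val: "event_le E F \<Longrightarrow> lit_val E l = Bot \<or> lit_val E l = lit_val F l"
  by (cases l) (simp_all add: event_le_def, metis neg_status.simps(1))

lemma sc_le_trans: "sc_le X Y \<Longrightarrow> sc_le Y Z \<Longrightarrow> sc_le X Z"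
  by (auto simp: sc_le_def)

lemma sc_le_minus_sig: "sc_le X Y \<Longrightarrow> sc_le (sc_minus_sig X s) (sc_minus_sig Y s)"
  by (auto simp: sc_le_def sc_minus_sig_def)

section \<open>Monotonicity of Must and Can\<close>

lemma Max_codes_mono: "K \<subseteq> K' \<Longrightarrow> L \<subseteq> L' \<Longrightarrow> Max_codes K L \<subseteq> Max_codes K' L'"
  by (auto simp: Max_codes_def)

lemma Max_codes_singleton [simp]: "Max_codes {k} {l} = {max k l}"
  by (auto simp: Max_codes_def)

text \<open>An unknown test leaves \<open>must\<close> empty, and the maximum of single codes is
  single. Monotonicity of Must for \<open>Seq\<close> rests on this.\<close>

lemma must_code_unique: "\<exists>k. snd (must p E) \<subseteq> {k}"
proof (induction p arbitrary: E)
  case (Trap p)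
  obtain k where "snd (must p E) \<subseteq> {k}" using Trap.IH by blast
  then have "snd (must (Trap p) E) \<subseteq> {down k}" by auto
  then show ?case by blast
next
  case (Shift p)
  obtain k where "snd (must p E) \<subseteq> {k}" using Shift.IH by blast
  then have "snd (must (Shift p) E) \<subseteq> {up k}" by auto
  then show ?case by blast
next
  case (Par p q)
  obtain k l where "snd (must p E) \<subseteq> {k}" "snd (must q E) \<subseteq> {l}"
    using Par.IH by metis
  then have "snd (must (Par p q) E) \<subseteq> {max k l}"
    using Max_codes_mono[of _ "{k}" _ "{l}"] by simp
  then show ?case by blast
qed (simp_all add: sc_minus_sig_def split: status.split)

text \<open>In mode \<open>MPlus\<close>, \<open>can\<close> gives a local signal the same status as
  \<open>must\<close>, and it too enters \<open>q\<close> with \<open>MPlus\<close> once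
  \<open>p\<close> must terminate. So structural induction suffices.\<close>

lemma must_le_can: "sc_le (must p E) (can MPlus p E)"
proof (induction p arbitrary: E)
  case (Par p q)
  from Par.IH(1)[of E] Par.IH(2)[of E] show ?case
    by (auto simp: sc_le_def intro: Max_codes_mono[THEN subsetD])
next
  case (Seq p q)
  from Seq.IH(1)[of E] Seq.IH(2)[of E] show ?case
    by (auto simp: sc_le_def sc_union_def sc_minus0_def)
next
  case (Local p s)
  then show ?case by (simp add: sc_le_minus_sig)
qed (auto simp: sc_le_def split: status.splits)

text \<open>The two halves need each other: for a local signal, Must decides \<open>Plus\<close> and
  Can decides \<open>Minus\<close>. The modes vary because an unknown test or termination switches
  \<open>can\<close> to \<open>MBot\<close>.\<close>

lemma must_can_mono:
  assumes "event_le E F" "mode_le m n"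
  shows "sc_le (must p E) (must p F) \<and> sc_le (can n p F) (can m p E)"
  using assms
proof (induction p arbitrary: E F m n)
  case (Await l)
  from event_le_lit_val[OF Await.prems(1), of l] show ?case
    by (auto simp: sc_le_def split: status.splits)
next
  case (Present s p q)
  have s: "val E s = Bot \<or> val E s = val F s"
    using Present.prems by (auto simp: event_le_def)
  \<comment> \<open>A test unknown at \<open>E\<close> gives \<open>can MBot\<close> there, while
    one known at \<open>F\<close> keeps the mode \<open>n\<close>.\<close>
  have "mode_le MBot n" by (simp add: mode_le_def)
  note IH = Present.IH(1)[OF Present.prems] Present.IH(2)[OF Present.prems]
    Present.IH(1)[OF Present.prems(1) this] Present.IH(2)[OF Present.prems(1) this]
    Present.IH(1)[OF Present.prems(1), of MBot MBot]
    Present.IH(2)[OF Present.prems(1), of MBot MBot]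
  from s IH show ?case
    by (cases "val E s"; cases "val F s") (auto simp: sc_le_def sc_union_def mode_le_def)
next
  case (Seq p q)
  have modes: "mode_le MPlus MPlus" "mode_le MBot MBot" "mode_le MBot MPlus"
    by (auto simp: mode_le_def)
  have q: "sc_le (must q E) (must q F)" "sc_le (can MPlus q F) (can MPlus q E)"
     "sc_le (can MBot q F) (can MBot q E)" "sc_le (can MPlus q F) (can MBot q E)"
    using Seq.IH(2)[OF Seq.prems(1)] modes by blast+
  have p: "sc_le (must p E) (must p F)" "sc_le (can n p F) (can m p E)"
    using Seq.IH(1)[OF Seq.prems] by auto
  have "sc_le (must (Seq p q) E) (must (Seq p q) F)"
  proof (cases "0 \<in> snd (must p F) \<and> 0 \<notin> snd (must p E)")
    case True
    \<comment> \<open>At \<open>F\<close> the only code of \<open>p\<close> is 0, so at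
      \<open>E\<close> there was none: no code is lost when \<open>F\<close> passes on to
      \<open>q\<close>.\<close>
    then have "snd (must p E) = {}"
      using p(1) must_code_unique[of p F] by (auto simp: sc_le_def)
    then show ?thesis using True p by (auto simp: sc_le_def)
  next
    case False
    then show ?thesis using p q by (auto simp: sc_le_def)
  qed
  moreover have "sc_le (can n (Seq p q) F) (can m (Seq p q) E)"
    using p q Seq.prems(2)
    by (auto simp: sc_le_def sc_union_def sc_minus0_def mode_le_def)
  ultimately show ?case ..
next
  case (Par p q)
  from Par.IH(1)[OF Par.prems] Par.IH(2)[OF Par.prems] show ?case
    by (auto simp: sc_le_def intro: Max_codes_mono[THEN subsetD])
next
  case (Local p s)
  \<comment> \<open>\<open>B m E\<close> is the status that \<open>can m\<close> gives to
    \<open>s\<close>; \<open>B MPlus E\<close> is also the one used by \<open>must\<close>.\<close>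
  define B :: "mode \<Rightarrow> 'a event \<Rightarrow> status" where "B m E =
    (if s \<in> fst (must p (fmupd s Bot E)) \<and> m = MPlus then Plus
     else if s \<notin> fst (can m p (fmupd s Bot E)) then Minus else Bot)" for m E
  have must_Local: "must (Local p s) E = sc_minus_sig (must p (fmupd s (B MPlus E) E)) s" for E
    by (simp add: B_def)
  have can_Local: "can m (Local p s) E = sc_minus_sig (can m p (fmupd s (B m E) E)) s" for m E
    by (simp add: B_def)
  \<comment> \<open>A decided status persists: \<open>Plus\<close> because Must grows,
    \<open>Minus\<close> because Can shrinks and \<open>must_le_can\<close> then excludes
    \<open>Plus\<close>.\<close>
  have B_mono: "B m E = Bot \<or> B m E = B n F" if "mode_le m n" for m n
    using Local.IH[OF event_le_fmupd[OF Local.prems(1), of Bot Bot s] that]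
      must_le_can[of p "fmupd s Bot F"] that
    by (cases n) (auto simp: B_def sc_le_def mode_le_def)
  have "sc_le (must (Local p s) E) (must (Local p s) F)"
    unfolding must_Local
    by (rule sc_le_minus_sig, rule Local.IH[THEN conjunct1, of _ _ MPlus MPlus],
        rule event_le_fmupd[OF Local.prems(1)], rule B_mono) (simp_all add: mode_le_def)
  moreover have "sc_le (can n (Local p s) F) (can m (Local p s) E)"
    unfolding can_Local using Local.prems(2)
    by (intro sc_le_minus_sig Local.IH[THEN conjunct2] event_le_fmupd[OF Local.prems(1)] B_mono)
  ultimately show ?case ..
next
  case (Trap p)
  from Trap.IH[OF Trap.prems] show ?case by (auto simp: sc_le_def)
next
  case (Shift p)
  from Shift.IH[OF Shift.prems] show ?case by (auto simp: sc_le_def)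
qed (simp_all add: sc_le_def)

text \<open>The chain passes through \<open>can MPlus p (fmupd s b E)\<close>. It serves the rule
  that sets a local signal to \<open>Minus\<close>.\<close>

lemma must_fmupd_le_can_Bot: "sc_le (must p (fmupd s b E)) (can MPlus p (fmupd s Bot E))"
  using must_le_can must_can_mono[of "fmupd s Bot E" "fmupd s b E" MPlus MPlus p]
    event_le_fmupd[of E E Bot b s]
  by (auto intro: sc_le_trans simp: mode_le_def)

lemma must_mono_fmupd_Bot: "sc_le (must p (fmupd s Bot E)) (must p (fmupd s b E))"
  using must_can_mono[of "fmupd s Bot E" "fmupd s b E" MPlus MPlus p]
    event_le_fmupd[of E E Bot b s]
  by (auto simp: mode_le_def)

section \<open>Domains and emitted signals of constructive outputs\<close>

lemma fmlookup_fmpointwise: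
  "fmlookup (fmpointwise f M N) x = (case fmlookup M x of None \<Rightarrow> None
     | Some a \<Rightarrow> (case fmlookup N x of None \<Rightarrow> None | Some b \<Rightarrow> Some (f a b)))"
  by (simp add: fmpointwise.rep_eq)

lemma fmdom_fmpointwise [simp]: "fmdom (fmpointwise f M N) = fmdom M |\<inter>| fmdom N"
  by (rule fset_eqI) (simp add: fmlookup_dom_iff fmlookup_fmpointwise split: option.split)

lemma fmdom_hide: "fmdom E' = finsert s (fmdom E) \<Longrightarrow> fmdom (hide E E' s) = fmdom E"
  by (auto simp: hide_def)

text \<open>\<open>event_union\<close> keeps only the common domain; equal domains ensure that no
  emitted signal is lost.\<close>

lemma CBS_fmdom: "CBS p E E' k p' \<Longrightarrow> fmdom E' = fmdom E"
  by (induction rule: CBS.induct)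
    (auto simp: out_none_def out_single_def event_union_def fmdom_hide)

lemma val_out_none [simp]: "val (out_none E) t \<noteq> Plus"
  by (auto simp: val_def out_none_def split: option.splits)

lemma val_out_single:
  "s |\<in>| fmdom E \<Longrightarrow> val (out_single E s) t = Plus \<longleftrightarrow> t = s"
  by (auto simp: val_def out_single_def fmlookup_dom_iff split: option.splits)

lemma val_event_union:
  "fmdom E = fmdom F \<Longrightarrow> val (event_union E F) t = Plus \<longleftrightarrow> val E t = Plus \<or> val F t = Plus"
  by (auto simp: val_def event_union_def fmlookup_fmpointwise join_status_def
      split: option.splits dest: fmdomI fmdom_notI)

lemma val_hide: "val (hide E E' s) t = Plus \<longleftrightarrow> t \<noteq> s \<and> val E' t = Plus"
  by (auto simp: val_def hide_def)

text \<open>Every CBS rule follows the branch that \<open>must\<close> takes, since the status it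
  reads is \<open>Plus\<close> or \<open>Minus\<close>.\<close>

lemma must_CBS:
  "CBS p E E' k p' \<Longrightarrow> must p E = ({s. val E' s = Plus}, {k})"
proof (induction rule: CBS.induct)
  case (CBS_Seq_Next p E E'p p' q E'q k q')
  then show ?case
    using val_event_union[of E'p E'q] by (auto simp: CBS_fmdom)
next
  case (CBS_Par p E E'p kp p' q E'q kq q' k)
  then show ?case
    using val_event_union[of E'p E'q] by (auto simp: CBS_fmdom)
next
  case (CBS_Local_Minus s p E E' k p')
  \<comment> \<open>\<open>must\<close> asks for \<open>Plus\<close> first, so this test has to fail
    before \<open>Minus\<close> is chosen.\<close>
  then have "s \<notin> fst (must p (fmupd s Bot E))"
    using must_fmupd_le_can_Bot by (fastforce simp: sc_le_def)
  with CBS_Local_Minus show ?case by (auto simp: val_hide sc_minus_sig_def)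
qed (auto simp: val_out_single val_hide sc_minus_sig_def)

section \<open>Totality and the passage to classical events\<close>

lemma total_event_union:
  "total_event E \<Longrightarrow> total_event F \<Longrightarrow> total_event (event_union E F)"
  unfolding total_event_def event_union_def fmlookup_fmpointwise join_status_def
  by (auto split: option.splits) (metis status.exhaust)+

lemma total_event_fmupd: "total_event E \<Longrightarrow> b \<noteq> Bot \<Longrightarrow> total_event (fmupd s b E)"
  by (auto simp: total_event_def)

text \<open>Basic outputs hold only \<open>Plus\<close> and \<open>Minus\<close>, a join is
  \<open>Bot\<close> only if an argument is, and hiding writes \<open>Minus\<close> or drops
  \<open>s\<close>.\<close>

lemma CBS_total: "CBS p E E' k p' \<Longrightarrow> total_event E'"
  by (induction rule: CBS.induct)
    (auto simp: total_event_union, auto simp: total_event_def out_none_def out_single_def hide_def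
      split: if_splits)

lemma cval_C2K: "total_event E \<Longrightarrow> cval (C2K E) s = val E s"
  unfolding cval_def C2K_def val_def total_event_def
  by (auto split: option.splits) (metis c2k_status.simps k2c_status.simps status.exhaust)

lemma lit_cval_C2K: "total_event E \<Longrightarrow> lit_cval (C2K E) l = lit_val E l"
  by (cases l) (auto simp: cval_C2K)

lemma fmdom_C2K [simp]: "fmdom (C2K E) = fmdom E"
  by (simp add: C2K_def)

lemma C2K_fmupd [simp]: "C2K (fmupd s b E) = fmupd s (c2k_status b) (C2K E)"
  by (rule fmap_ext) (simp add: C2K_def)

lemma C2K_out_none [simp]: "C2K (out_none E) = cout_none (C2K E)"
  by (rule fmap_ext) (simp add: C2K_def out_none_def cout_none_def option.map_comp comp_def)

lemma C2K_out_single [simp]: "C2K (out_single E s) = cout_single (C2K E) s"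
  by (rule fmap_ext)
    (simp add: C2K_def out_single_def cout_single_def option.map_comp comp_def if_distrib)

lemma C2K_hide [simp]: "C2K (hide E E' s) = chide (C2K E) (C2K E') s"
  by (rule fmap_ext) (auto simp: C2K_def hide_def chide_def)

lemma C2K_event_union:
  assumes "total_event E" "total_event F"
  shows "C2K (event_union E F) = cevent_union (C2K E) (C2K F)"
proof (rule fmap_ext)
  \<comment> \<open>Restricted to known statuses, as \<open>c2k_status Bot\<close> is
    unspecified.\<close>
  have "c2k_status (join_status a b) = join_cstatus (c2k_status a) (c2k_status b)"
    if "a \<noteq> Bot" "b \<noteq> Bot" for a b
    using that by (cases a; cases b) (auto simp: join_status_def join_cstatus_def)
  then show "fmlookup (C2K (event_union E F)) t = fmlookup (cevent_union (C2K E) (C2K F)) t" for t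
    using assms
    by (auto simp: C2K_def event_union_def cevent_union_def fmlookup_fmpointwise total_event_def
        split: option.split) metis
qed

theorem theorem6:
  fixes p p' :: "('s::infinite) stm" and E E' :: "'s event" and k :: nat
  assumes "total_event E" and "CBS p E E' k p'"
  shows "LBS p (C2K E) (C2K E') k p'"
  \<comment> \<open>Totality goes through the induction, since the local rules change the input
    event.\<close>
  using assms(2,1)
proof (induction rule: CBS.induct)
  case (CBS_Local_Plus s p E E' k p')
  \<comment> \<open>Membership in Must at \<open>Bot\<close> persists at \<open>Plus\<close>, where
    Must consists of the emitted signals.\<close>
  have "val E' s = Plus"
    using must_mono_fmupd_Bot[of p s E Plus] must_CBS[OF CBS_Local_Plus.hyps(2)]
      CBS_Local_Plus.hyps(1)
    by (auto simp: sc_le_def)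
  then show ?case
    using CBS_Local_Plus CBS_total[OF CBS_Local_Plus.hyps(2)]
    by (auto intro!: LBS.LBS_Local_Plus simp: cval_C2K total_event_fmupd)
next
  case (CBS_Local_Minus s p E E' k p')
  \<comment> \<open>An emitted \<open>s\<close> would be in Must at \<open>Minus\<close>, hence in
    Can at \<open>Bot\<close>.\<close>
  have "val E' s \<noteq> Plus"
    using must_fmupd_le_can_Bot[of p s Minus E] must_CBS[OF CBS_Local_Minus.hyps(2)]
      CBS_Local_Minus.hyps(1)
    by (auto simp: sc_le_def)
  then show ?case
    using CBS_Local_Minus CBS_total[OF CBS_Local_Minus.hyps(2)]
    by (auto intro!: LBS.LBS_Local_Minus simp: cval_C2K total_event_fmupd)
next
  case (CBS_Seq_Next p E E'p p' q E'q k q')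
  then show ?case
    using CBS_total[of p] CBS_total[of q] by (auto intro: LBS.intros simp: C2K_event_union)
next
  case (CBS_Par p E E'p kp p' q E'q kq q' k)
  then show ?case
    using CBS_total[of p] CBS_total[of q] by (auto intro: LBS.intros simp: C2K_event_union)
\<comment> \<open>The code of a waiting \<open>Await\<close> has to keep the form \<open>1\<close>
  in which \<open>LBS_Await_Minus\<close> states it.\<close>
qed (auto intro: LBS.intros simp: cval_C2K lit_cval_C2K simp del: One_nat_def)

end
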